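(* Let $q\in\mathbb{C}\setminus\{0\}$ be such that $|q|\neq 1$, and let $a$, $b$ and $c$ be relatively $q$-prime polynomials in $\mathbb{C}[z]$ such that $$a+b=c$$ and such that $a$, $b$ and $c$ are not all constants. Then $$\max\{\deg(a),\deg(b),\deg(c)\}\leq \deg(\mathrm{rad}_q(abc))-1.$$
   Context: For $w\in\mathbb{C}$: $[z-w]_q^0=1$ and $[z-w]_q^n=(z-w)(z-wq)\cdots(z-wq^{n-1})$ for $n\ge 1$ (so $[z-0]_q^n=z^n$). The $q$-derivative is $D_qf(z)=\frac{f(qz)-f(z)}{qz-z}$ for $z\neq 0$, and $D_qf(0)=f'(0)$; $D_q^0f=f$, $D_q^nf=D_q^{n-1}(D_qf)$. A point $z_0$ is a zero of $f$ with $q$-weight $n$ if $D_q^kf(z_0)=0$ for all $0\le k<n$, but $D_q^nf(z_0)\neq0$ (infinite $q$-weight if $D_q^kf(z_0)=0$ for all $k\ge0$). $q$-difference radical: let $P$ be a nonzero polynomial. Choose a zero $z_1$ of $P$ with $P(q^{-1}z_1)\neq0$, of $q$-weight $n_1$, and write $P(z)=[z-z_1]_q^{n_1}P_1(z)$ with $P_1(q^{n_1}z_1)\ne0$; then choose a zero $z_2$ of $P_1$ with $P_1(q^{-1}z_2)\ne0$, of $q$-weight $n_2$ as a zero of $P_1$, write $P_1(z)=[z-z_2]_q^{n_2}P_2(z)$, and so on. A zero at the origin of multiplicity $n$ contributes the single factor $[z-0]_q^n=z^n$. This gives a representation, unique up to order, $$P(z)=A\prod_{j=1}^N[z-z_j]_q^{n_j},\qquad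 A\neq0,$$ where $z_j=z_k$ is possible for $j\neq k$. Then $\mathrm{rad}_q(P)=\prod_{j=1}^N(z-z_j)$. Common $q$-divisor: for entire $f,g$, the linear factor $z-z_0$ is a common $q$-divisor of $f$ and $g$ if there are a zero $z_1$ of $f$ with $q$-weight $m\geq 1$, a zero $z_2$ of $g$ with $q$-weight $n\geq 1$ ($q$-weights possibly infinite), integers $1\le m_1\le m$, $1\le n_1\le n$, and entire functions $F,G$ with $f(z)=[z-z_1]_q^{m_1}F(z)$, $g(z)=[z-z_2]_q^{n_1}G(z)$, such that $z_0\in\{z_1,z_2\}$ and $f(z)g(z)=[z-z_0]_q^{m_1+n_1}F(z)G(z)$. (If $z_0=z_1$ this means $z_2=q^{m_1}z_1$; if $z_0=z_2$ it means $z_1=q^{n_1}z_2$.) Two functions are relatively $q$-prime if they have no nonconstant common $q$-divisor; more than two functions are relatively $q$-prime if every pair of them is. *)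

theory Defs
  imports
    "HOL-Analysis.Analysis"
    "HOL-Library.Extended_Nat"
    "HOL-Computational_Algebra.Polynomial"
begin

text \<open>The polynomial \<open>[z - w]\<^sub>q\<^sup>n\<close> in the variable \<open>z\<close>.\<close>

definition q_shifted_power :: "complex \<Rightarrow> complex \<Rightarrow> nat \<Rightarrow> complex poly" where
  "q_shifted_power q w n = (\<Prod>k<n. [:- (w * q ^ k), 1:])"

definition q_deriv :: "complex \<Rightarrow> (complex \<Rightarrow> complex) \<Rightarrow> complex \<Rightarrow> complex" where
  "q_deriv q f z = (if z = 0 then deriv f 0 else (f (q * z) - f z) / (q * z - z))"

text \<open>The point \<open>z\<close> has \<open>q\<close>-weight \<open>w\<close> for \<open>f\<close>. It is a zero of \<open>f\<close> exactly if \<open>w \<ge> 1\<close>;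
  for \<open>w = \<infinity>\<close> the second conjunct is vacuous.\<close>

definition has_q_weight :: "complex \<Rightarrow> (complex \<Rightarrow> complex) \<Rightarrow> complex \<Rightarrow> enat \<Rightarrow> bool" where
  "has_q_weight q f z w \<longleftrightarrow>
     (\<forall>k. enat k < w \<longrightarrow> (q_deriv q ^^ k) f z = 0) \<and>
     (\<forall>n. w = enat n \<longrightarrow> (q_deriv q ^^ n) f z \<noteq> 0)"

text \<open>\<open>q_factorization q P [(z\<^sub>1, n\<^sub>1), \<dots>, (z\<^sub>N, n\<^sub>N)]\<close> says that successively splitting off
  \<open>[z - z\<^sub>1]\<^sub>q\<^bsup>n\<^sub>1\<^esup>, \<dots>, [z - z\<^sub>N]\<^sub>q\<^bsup>n\<^sub>N\<^esup>\<close> reduces \<open>P\<close> to a nonzero constant. The condition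
  \<open>poly P (inverse q * z\<^sub>1) \<noteq> 0\<close> of rule \<open>step\<close> can never hold at a zero \<open>z\<^sub>1 = 0\<close>, so the origin
  is treated by its own rule, which may be applied at any stage.\<close>

inductive q_factorization :: "complex \<Rightarrow> complex poly \<Rightarrow> (complex \<times> nat) list \<Rightarrow> bool"
  for q :: complex where
  const: "A \<noteq> 0 \<Longrightarrow> q_factorization q [:A:] []"
| origin: "poly P 0 = 0 \<Longrightarrow> n = order 0 P \<Longrightarrow>
    P = q_shifted_power q 0 n * P\<^sub>1 \<Longrightarrow>
    q_factorization q P\<^sub>1 xs \<Longrightarrow> q_factorization q P ((0, n) # xs)"
| step: "poly P z\<^sub>1 = 0 \<Longrightarrow> poly P (inverse q * z\<^sub>1) \<noteq> 0 \<Longrightarrow>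
    has_q_weight q (poly P) z\<^sub>1 (enat n\<^sub>1) \<Longrightarrow>
    P = q_shifted_power q z\<^sub>1 n\<^sub>1 * P\<^sub>1 \<Longrightarrow> poly P\<^sub>1 (q ^ n\<^sub>1 * z\<^sub>1) \<noteq> 0 \<Longrightarrow>
    q_factorization q P\<^sub>1 xs \<Longrightarrow> q_factorization q P ((z\<^sub>1, n\<^sub>1) # xs)"

text \<open>Well defined if \<open>P \<noteq> 0\<close>, \<open>q \<noteq> 0\<close> and \<open>norm q \<noteq> 1\<close>: the factorization then exists
  and is unique up to order.\<close>

definition q_radical :: "complex \<Rightarrow> complex poly \<Rightarrow> complex poly" where
  "q_radical q P =
     (THE R. \<exists>xs. q_factorization q P xs \<and> R = (\<Prod>(z, n)\<leftarrow>xs. [:- z, 1:]))"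

text \<open>The linear factor \<open>z - z\<^sub>0\<close> is represented by its zero \<open>z\<^sub>0\<close>. The factorizations
  force \<open>f\<close> and \<open>g\<close> to be entire.\<close>

definition common_q_divisor ::
  "complex \<Rightarrow> (complex \<Rightarrow> complex) \<Rightarrow> (complex \<Rightarrow> complex) \<Rightarrow> complex \<Rightarrow> bool" where
  "common_q_divisor q f g z\<^sub>0 \<longleftrightarrow>
     (\<exists>z\<^sub>1 z\<^sub>2 m n m\<^sub>1 n\<^sub>1 F G.
        has_q_weight q f z\<^sub>1 m \<and> 1 \<le> m \<and>
        has_q_weight q g z\<^sub>2 n \<and> 1 \<le> n \<and>
        1 \<le> m\<^sub>1 \<and> enat m\<^sub>1 \<le> m \<and> 1 \<le> n\<^sub>1 \<and> enat n\<^sub>1 \<le> n \<and>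
        F holomorphic_on UNIV \<and> G holomorphic_on UNIV \<and>
        (\<forall>z. f z = poly (q_shifted_power q z\<^sub>1 m\<^sub>1) z * F z) \<and>
        (\<forall>z. g z = poly (q_shifted_power q z\<^sub>2 n\<^sub>1) z * G z) \<and>
        z\<^sub>0 \<in> {z\<^sub>1, z\<^sub>2} \<and>
        (\<forall>z. f z * g z = poly (q_shifted_power q z\<^sub>0 (m\<^sub>1 + n\<^sub>1)) z * F z * G z))"

text \<open>Every common \<open>q\<close>-divisor is a linear factor, hence nonconstant. A list, not a set, of
  functions is used because the same function may occur twice.\<close>

definition relatively_q_prime :: "complex \<Rightarrow> (complex \<Rightarrow> complex) list \<Rightarrow> bool" where
  "relatively_q_prime q fs \<longleftrightarrow>
     (\<forall>i<length fs. \<forall>j<length fs. i \<noteq> j \<longrightarrow> (\<nexists>z\<^sub>0. common_q_divisor q (fs ! i) (fs ! j) z\<^sub>0))"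

end

theory Submission
  imports Defs "HOL-Computational_Algebra.Fundamental_Theorem_Algebra"
begin

text \<open>
  This is a difference analogue of the Wronskian proof of Mason's theorem. Write
  \<open>m z = order z P\<close> for \<open>P = a * b * c\<close>.

  \<^emph>\<open>The radical counts the upward jumps of the multiplicity.\<close> At a point \<open>z \<noteq> 0\<close> the
  \<open>q\<close>-weight is the length of the run of zeros \<open>z, q * z, q\<^sup>2 * z, \<dots>\<close>, so each step of the
  factorization removes one maximal run and thereby lowers the jump \<open>m z - m (z / q)\<close> by one at
  the start of the run and nowhere else. Hence \<open>z\<close> occurs in every factorization exactly
  \<open>max 0 (m z - m (z / q))\<close> times, and the origin once if it is a zero
  (\<open>count_q_factorization\<close>). This makes the radical well defined and gives its degree.
  Compared with the degree of \<open>P\<close>, the radical misses \<open>min (m z) (m (z / q))\<close> at each \<open>z \<noteq> 0\<close>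
  and \<open>m 0 - 1\<close> at a zero at the origin.

  \<^emph>\<open>The Casoratian pays for what the radical misses.\<close> Put
  \<open>D(z) = a(z) * b(q * z) - a(q * z) * b(z)\<close>. By \<open>a + b = c\<close> it is up to sign the same for any
  two of \<open>a\<close>, \<open>b\<close>, \<open>c\<close>, so its degree is at most the sum of any two of their degrees.
  If one of the three polynomials vanishes to order at least \<open>n\<close> at both \<open>w\<close> and \<open>q * w\<close>,
  then \<open>D\<close> vanishes to order at least \<open>n\<close> at \<open>w\<close>. Relative \<open>q\<close>-primality says that consecutive
  zeros \<open>w\<close> and \<open>q * w\<close> of \<open>P\<close> come from one and the same factor
  (\<open>consecutive_zeros_in_one_factor\<close>), so \<open>D\<close> vanishes at \<open>z / q\<close> to order at least
  \<open>min (m z) (m (z / q))\<close>. Moreover \<open>D(0) = 0\<close>, which supplies the summand \<open>1\<close> in the bound.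
  Summing over all points, if \<open>D \<noteq> 0\<close>, gives
  \<open>deg a + deg b + deg c + 1 \<le> deg rad P + deg D\<close>
  (\<open>degree_prod_less_radical_plus\<close>), and the claim follows from the degree bounds for \<open>D\<close>.

  \<^emph>\<open>A vanishing Casoratian is possible\<close>, because two relatively \<open>q\<close>-prime polynomials may share
  zeros away from the origin. Then \<open>a\<close>, \<open>b\<close>, \<open>c\<close> are proportional, so \<open>P\<close> has no
  two consecutive zeros, the radical has the full degree \<open>3 * deg a\<close>, and the inequality holds
  with room to spare.
\<close>

section \<open>The Casoratian\<close>

text \<open>Up to the factor \<open>(q - 1) * z\<close> this is the \<open>q\<close>-Wronskian \<open>f * D\<^sub>q g - g * D\<^sub>q f\<close>; keeping that
  factor avoids a division by \<open>z\<close>.\<close>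

definition casoratian :: "'a::comm_ring_1 \<Rightarrow> 'a poly \<Rightarrow> 'a poly \<Rightarrow> 'a poly" where
  "casoratian q f g = f * pcompose g [:0, q:] - pcompose f [:0, q:] * g"

lemma pcompose_power: "pcompose (p ^ n) r = pcompose p r ^ n"
  for p r :: "'a::comm_semiring_1 poly"
  by (induction n) (simp_all add: pcompose_1 pcompose_mult)

lemma linear_power_dvd_pcompose_scale:
  fixes f :: "'a::field poly"
  assumes "q \<noteq> 0" and "[:- (q * z), 1:] ^ n dvd f"
  shows "[:- z, 1:] ^ n dvd pcompose f [:0, q:]"
proof -
  obtain h where h: "f = [:- (q * z), 1:] ^ n * h"
    using assms(2) by (auto elim: dvdE)
  have lin: "pcompose [:- (q * z), 1:] [:0, q:] = smult q [:- z, 1:]"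
    by (simp add: pcompose_pCons)
  have "pcompose f [:0, q:] = (smult q [:- z, 1:]) ^ n * pcompose h [:0, q:]"
    by (simp only: h pcompose_mult pcompose_power lin)
  also have "\<dots> = [:- z, 1:] ^ n * smult (q ^ n) (pcompose h [:0, q:])"
    by (simp only: smult_power mult_smult_left mult_smult_right)
  finally show ?thesis
    by (metis dvd_triv_left)
qed

text \<open>The counterpart of the fact that a multiple zero of \<open>f\<close> is a zero of the Wronskian of \<open>f\<close>
  and \<open>g\<close>: each of the two terms contains \<open>f(z)\<close> or \<open>f(q * z)\<close> as a factor.\<close>

lemma linear_power_dvd_casoratian:
  fixes f :: "'a::field poly"
  assumes "q \<noteq> 0" and "[:- z, 1:] ^ n dvd f" and "[:- (q * z), 1:] ^ n dvd f"
  shows "[:- z, 1:] ^ n dvd casoratian q f g"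
  unfolding casoratian_def
  using linear_power_dvd_pcompose_scale[OF assms(1,3)] assms(2) by simp

lemma degree_casoratian_le: "degree (casoratian q f g) \<le> degree f + degree (g :: 'a::comm_ring_1 poly)"
proof -
  have scale: "degree (pcompose h [:0, q:]) \<le> degree h" for h :: "'a poly"
    using degree_pcompose_le[of h "[:0, q:]"] by (auto split: if_splits)
  have "degree (f * pcompose g [:0, q:]) \<le> degree f + degree g"
    using degree_mult_le[of f "pcompose g [:0, q:]"] scale[of g] by linarith
  moreover have "degree (pcompose f [:0, q:] * g) \<le> degree f + degree g"
    using degree_mult_le[of "pcompose f [:0, q:]" g] scale[of f] by linarith
  ultimately show ?thesis
    unfolding casoratian_def by (rule degree_diff_le)
qed

text \<open>The Casoratian is bilinear and alternating, so three polynomials with \<open>a + b = c\<close> have, up to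
  sign, only one Casoratian.\<close>

lemma casoratian_add_right: "casoratian q f (f + g) = casoratian q f g"
  and casoratian_add_left: "casoratian q (f + g) g = casoratian q f g"
  and casoratian_commute: "casoratian q g f = - casoratian q f g"
  by (simp_all add: casoratian_def pcompose_add algebra_simps)

lemma poly_casoratian_0: "poly (casoratian q f g) 0 = 0"
  by (simp add: casoratian_def poly_pcompose)

section \<open>Shifted powers and runs of zeros\<close>

lemma q_shifted_power_Suc:
  "q_shifted_power q w (Suc n) = q_shifted_power q w n * [:- (w * q ^ n), 1:]"
  by (simp add: q_shifted_power_def)

lemma q_shifted_power_nonzero: "q_shifted_power q w n \<noteq> 0"
  by (simp add: q_shifted_power_def)

lemma q_shifted_power_origin: "q_shifted_power q 0 n = [:0, 1:] ^ n"
  by (simp add: q_shifted_power_def)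

lemma degree_q_shifted_power: "degree (q_shifted_power q w n) = n"
  by (simp add: q_shifted_power_def degree_prod_sum_eq)

text \<open>The number of runs that begin at \<open>z\<close> when the zeros of \<open>P\<close> with their multiplicities are
  decomposed into maximal runs. The subtraction is truncated on purpose: a decrease of the
  multiplicity from \<open>z / q\<close> to \<open>z\<close> means that runs end, not that new ones begin. All the zeros
  at the origin make up a single factor.\<close>

definition chain_starts :: "complex \<Rightarrow> complex poly \<Rightarrow> complex \<Rightarrow> nat" where
  "chain_starts q P z =
     (if z = 0 then of_bool (poly P 0 = 0) else order z P - order (z / q) P)"

section \<open>Relatively q-prime polynomials\<close>

lemma zero_has_positive_q_weight:
  assumes "f z = 0"
  obtains w where "has_q_weight q f z w" and "1 \<le> w"
proof (cases "\<exists>n. (q_deriv q ^^ n) f z \<noteq> 0")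
  case True
  define n where "n = (LEAST n. (q_deriv q ^^ n) f z \<noteq> 0)"
  have n: "(q_deriv q ^^ n) f z \<noteq> 0"
    unfolding n_def using True by (rule LeastI_ex)
  have "(q_deriv q ^^ k) f z = 0" if "k < n" for k
    using that not_less_Least unfolding n_def by blast
  moreover have "n \<noteq> 0"
    using n assms by (intro notI) simp
  ultimately show thesis
    using n that[of "enat n"] by (auto simp: has_q_weight_def one_enat_def)
next
  case False
  then show thesis
    using that[of \<infinity>] by (simp add: has_q_weight_def)
qed

text \<open>Two runs of length one, at \<open>z\<close> for \<open>f\<close> and at \<open>q * z\<close> for \<open>g\<close>, join to a run of length two.\<close>

lemma common_q_divisorI:
  assumes "poly f z = 0" and "poly g (q * z) = 0"
  shows "common_q_divisor q (poly f) (poly g) z"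
proof -
  obtain m where m: "has_q_weight q (poly f) z m" "1 \<le> m"
    using zero_has_positive_q_weight[of "poly f" z] assms(1) by blast
  obtain n where n: "has_q_weight q (poly g) (q * z) n" "1 \<le> n"
    using zero_has_positive_q_weight[of "poly g" "q * z"] assms(2) by blast
  obtain F where F: "f = [:- z, 1:] * F"
    using assms(1) unfolding poly_eq_0_iff_dvd by (rule dvdE)
  obtain G where G: "g = [:- (q * z), 1:] * G"
    using assms(2) unfolding poly_eq_0_iff_dvd by (rule dvdE)
  have q1: "q_shifted_power q w 1 = [:- w, 1:]" for w
    by (simp add: q_shifted_power_def)
  have q2: "q_shifted_power q z (1 + 1) = [:- z, 1:] * [:- (q * z), 1:]"
    by (simp add: q_shifted_power_def numeral_2_eq_2 mult.commute)
  have "\<forall>x. poly f x = poly (q_shifted_power q z 1) x * poly F x"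
    "\<forall>x. poly g x = poly (q_shifted_power q (q * z) 1) x * poly G x"
    "\<forall>x. poly f x * poly g x = poly (q_shifted_power q z (1 + 1)) x * poly F x * poly G x"
    unfolding q1 q2 unfolding F G by (simp_all add: algebra_simps)
  moreover have "poly F holomorphic_on UNIV" "poly G holomorphic_on UNIV"
    by (auto intro!: holomorphic_intros)
  ultimately show ?thesis
    unfolding common_q_divisor_def using m n
    by (intro exI[of _ z] exI[of _ "q * z"] exI[of _ m] exI[of _ n] exI[of _ 1]
        exI[of _ "poly F"] exI[of _ "poly G"])
      (simp add: one_enat_def)
qed

text \<open>No zero of one polynomial is followed by a zero of the other one. This is the form in
  which relative \<open>q\<close>-primality enters the counting of multiplicities. Common zeros are not
  excluded, except at the origin, which follows itself.\<close>

definition q_disjoint :: "complex \<Rightarrow> complex poly \<Rightarrow> complex poly \<Rightarrow> bool" where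
  "q_disjoint q f g \<longleftrightarrow>
     (\<forall>z. \<not> (poly f z = 0 \<and> poly g (q * z) = 0) \<and> \<not> (poly g z = 0 \<and> poly f (q * z) = 0))"

lemma q_disjoint_commute: "q_disjoint q f g \<longleftrightarrow> q_disjoint q g f"
  by (auto simp: q_disjoint_def)

lemma q_disjoint_if_relatively_q_prime:
  assumes "relatively_q_prime q (map poly ps)" and "i < length ps" and "j < length ps" and "i \<noteq> j"
  shows "q_disjoint q (ps ! i) (ps ! j)"
proof -
  have "\<not> common_q_divisor q (poly (ps ! k)) (poly (ps ! l)) z"
    if "k < length ps" "l < length ps" "k \<noteq> l" for k l z
    using assms(1) that unfolding relatively_q_prime_def by fastforce
  then show ?thesis
    unfolding q_disjoint_def using common_q_divisorI assms(2-4) by metis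
qed

text \<open>The zero polynomial vanishes everywhere, so the other polynomial can have no zero.\<close>

lemma q_disjoint_0_imp_constant:
  assumes "q_disjoint q 0 f"
  shows "degree f = 0"
  using assms fundamental_theorem_of_algebra[of f] constant_degree[of f]
  by (auto simp: q_disjoint_def)

text \<open>A factor that vanishes at \<open>w\<close> keeps the other two from vanishing at \<open>q * w\<close>, so it vanishes
  there itself, and this in turn keeps the other two from vanishing at \<open>w\<close>. At \<open>w = 0\<close> both points
  coincide and the argument is still valid.\<close>

lemma consecutive_zeros_in_one_factor:
  assumes "q_disjoint q f g" and "q_disjoint q f h" and "q_disjoint q g h"
    and "poly (f * g * h) w = 0" and "poly (f * g * h) (q * w) = 0"
  obtains r s where "r \<in> {f, g, h}" and "f * g * h = r * s"
    and "poly s w \<noteq> 0" and "poly s (q * w) \<noteq> 0"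
proof -
  consider "poly f w = 0" | "poly g w = 0" | "poly h w = 0"
    using assms(4) by auto
  then show thesis
  proof cases
    case 1
    with assms have "poly (g * h) w \<noteq> 0 \<and> poly (g * h) (q * w) \<noteq> 0"
      by (auto simp: q_disjoint_def)
    then show thesis
      by (intro that[of f "g * h"]) (auto simp: algebra_simps)
  next
    case 2
    with assms have "poly (f * h) w \<noteq> 0 \<and> poly (f * h) (q * w) \<noteq> 0"
      by (auto simp: q_disjoint_def)
    then show thesis
      by (intro that[of g "f * h"]) (auto simp: algebra_simps)
  next
    case 3
    with assms have "poly (f * g) w \<noteq> 0 \<and> poly (f * g) (q * w) \<noteq> 0"
      by (auto simp: q_disjoint_def)
    then show thesis
      by (intro that[of h "f * g"]) (auto simp: algebra_simps)
  qed
qed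

section \<open>Orbits under multiplication by q\<close>

context
  fixes q :: complex
  assumes q_nonzero: "q \<noteq> 0" and norm_q: "norm q \<noteq> 1"
begin

text \<open>This is where \<open>|q| \<noteq> 1\<close> enters: \<open>q\<close> is not a root of unity, so nonzero orbits are infinite.\<close>

lemma q_power_inj: "q ^ j = q ^ k \<longleftrightarrow> j = k"
proof -
  have "q ^ j \<noteq> q ^ k" if "j < k" for j k
  proof
    assume "q ^ j = q ^ k"
    then have "q ^ j * 1 = q ^ j * q ^ (k - j)"
      using that by (metis mult_1_right le_add_diff_inverse less_imp_le power_add)
    then have "q ^ (k - j) = 1"
      using q_nonzero by simp
    then show False
      using power_eq_1_iff[of q "k - j"] norm_q that by simp
  qed
  then show ?thesis
    by (metis linorder_neqE_nat)
qed

lemma q_not_1: "q \<noteq> 1"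
  using norm_q by auto

lemma orbit_leaves_zeros:
  assumes "P \<noteq> 0" and "z \<noteq> 0"
  shows "\<exists>n. poly P (q ^ n * z) \<noteq> 0" and "\<exists>n. poly P (z / q ^ n) \<noteq> 0"
proof -
  have fin: "finite {x. poly P x = 0}"
    by (rule poly_roots_finite) fact
  have "inj (\<lambda>n. q ^ n * z)" and "inj (\<lambda>n. z / q ^ n)"
    using assms(2) q_nonzero by (auto simp: inj_def q_power_inj field_simps)
  then have "\<not> range (\<lambda>n. q ^ n * z) \<subseteq> {x. poly P x = 0}"
    and "\<not> range (\<lambda>n. z / q ^ n) \<subseteq> {x. poly P x = 0}"
    using fin finite_subset range_inj_infinite by blast+
  then show "\<exists>n. poly P (q ^ n * z) \<noteq> 0" and "\<exists>n. poly P (z / q ^ n) \<noteq> 0"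
    by auto
qed

text \<open>Walking backwards along the orbit of \<open>z\<close> must leave the finite set of zeros; \<open>w\<close> is the
  last zero before this happens.\<close>

lemma chain_start_exists:
  assumes "P \<noteq> 0" and "z \<noteq> 0" and "poly P z = 0"
  obtains w where "w \<noteq> 0" and "poly P w = 0" and "poly P (w / q) \<noteq> 0"
proof -
  define n where "n = (LEAST n. poly P (z / q ^ n) \<noteq> 0)"
  have n: "poly P (z / q ^ n) \<noteq> 0"
    unfolding n_def using orbit_leaves_zeros(2)[OF assms(1,2)] by (rule LeastI_ex)
  have less: "poly P (z / q ^ k) = 0" if "k < n" for k
    using that not_less_Least unfolding n_def by blast
  have "n \<noteq> 0"
    using n assms(3) by (intro notI) simp
  then obtain k where k: "n = Suc k"
    using not0_implies_Suc by blast
  show thesis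
    using that[of "z / q ^ k"] n less[of k] assms(2) q_nonzero k
    by (simp add: field_simps)
qed

section \<open>The q-weight as the length of a run of zeros\<close>

text \<open>The \<open>n\<close>-th \<open>q\<close>-derivative at \<open>z\<close> is a linear combination of the values
  \<open>f z, f (q * z), \<dots>, f (q\<^sup>n * z)\<close>. If all but the last one vanish, only its nonzero multiple
  remains. The induction generalizes over \<open>f\<close>, since its hypothesis is applied to
  the \<open>q\<close>-derivative of \<open>f\<close>.\<close>

lemma q_deriv_funpow_at_first_nonzero:
  assumes "z \<noteq> 0" and "\<And>k. k < n \<Longrightarrow> f (q ^ k * z) = 0"
  shows "\<exists>c. c \<noteq> 0 \<and> (q_deriv q ^^ n) f z = c * f (q ^ n * z)"
  using assms(2)
proof (induction n arbitrary: f)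
  case 0
  show ?case by (rule exI[of _ 1]) simp
next
  case (Suc n)
  have D: "q_deriv q f (q ^ k * z) =
      (f (q ^ Suc k * z) - f (q ^ k * z)) / (q ^ k * z * (q - 1))" for k
    using assms(1) q_nonzero by (simp add: q_deriv_def algebra_simps)
  have "q_deriv q f (q ^ k * z) = 0" if "k < n" for k
    unfolding D using Suc.prems[of k] Suc.prems[of "Suc k"] that by simp
  then obtain c where c: "c \<noteq> 0"
    "(q_deriv q ^^ n) (q_deriv q f) z = c * q_deriv q f (q ^ n * z)"
    using Suc.IH by blast
  have "(q_deriv q ^^ Suc n) f z = c / (q ^ n * z * (q - 1)) * f (q ^ Suc n * z)"
    unfolding funpow_Suc_right o_apply c(2) D using Suc.prems[of n] by simp
  moreover have "c / (q ^ n * z * (q - 1)) \<noteq> 0"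
    using c(1) assms(1) q_nonzero q_not_1 by simp
  ultimately show ?case by blast
qed

lemma q_deriv_funpow_vanish_iff:
  assumes "z \<noteq> 0"
  shows "(\<forall>k<n. (q_deriv q ^^ k) f z = 0) \<longleftrightarrow> (\<forall>k<n. f (q ^ k * z) = 0)"
proof (induction n)
  case (Suc n)
  have "(q_deriv q ^^ n) f z = 0 \<longleftrightarrow> f (q ^ n * z) = 0" if "\<forall>k<n. f (q ^ k * z) = 0"
    using q_deriv_funpow_at_first_nonzero[OF assms, of n f] that by auto
  then show ?case
    using Suc.IH by (metis less_Suc_eq)
qed simp

lemma has_q_weight_iff_run_length:
  assumes "z \<noteq> 0"
  shows "has_q_weight q f z (enat n) \<longleftrightarrow> (\<forall>k<n. f (q ^ k * z) = 0) \<and> f (q ^ n * z) \<noteq> 0"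
proof -
  have "has_q_weight q f z (enat n) \<longleftrightarrow>
      (\<forall>k<n. f (q ^ k * z) = 0) \<and> (q_deriv q ^^ n) f z \<noteq> 0"
    by (simp add: has_q_weight_def flip: q_deriv_funpow_vanish_iff[OF assms])
  then show ?thesis
    using q_deriv_funpow_at_first_nonzero[OF assms, of n f] by auto
qed

lemma order_q_shifted_power:
  assumes "w \<noteq> 0"
  shows "order z (q_shifted_power q w n) = of_bool (\<exists>k<n. z = w * q ^ k)"
proof (induction n)
  case 0
  show ?case by (simp add: q_shifted_power_def order_0I)
next
  case (Suc n)
  have lin: "order z [:- (w * q ^ n), 1:] = of_bool (z = w * q ^ n)"
    using order_power_n_n[of z 1] by (auto intro!: order_0I)
  have "order z (q_shifted_power q w (Suc n)) =
      of_bool (\<exists>k<n. z = w * q ^ k) + of_bool (z = w * q ^ n)"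
    unfolding q_shifted_power_Suc
    by (subst order_mult) (simp_all add: q_shifted_power_nonzero Suc.IH lin del: mult_pCons_right)
  also have "\<dots> = of_bool (\<exists>k<Suc n. z = w * q ^ k)"
  proof (cases "z = w * q ^ n")
    case True
    then have "\<not> (\<exists>k<n. z = w * q ^ k)"
      using assms by (auto simp: q_power_inj)
    then show ?thesis
      using True by auto
  qed (auto simp: less_Suc_eq)
  finally show ?case .
qed

text \<open>The linear factors of a shifted power with \<open>z \<noteq> 0\<close> have distinct zeros, so they can be split
  off one by one.\<close>

lemma q_shifted_power_dvd:
  assumes "z \<noteq> 0" and "\<And>k. k < n \<Longrightarrow> poly P (q ^ k * z) = 0"
  shows "q_shifted_power q z n dvd P"
  using assms(2)
proof (induction n)
  case 0
  show ?case by (simp add: q_shifted_power_def)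
next
  case (Suc n)
  then obtain R where R: "P = q_shifted_power q z n * R"
    by (auto elim: dvdE)
  have "poly (q_shifted_power q z n) (q ^ n * z) \<noteq> 0"
    using assms(1) by (auto simp: q_shifted_power_def poly_prod q_power_inj)
  then have "poly R (z * q ^ n) = 0"
    using Suc.prems[of n] unfolding R by (simp add: mult.commute)
  then have "[:- (z * q ^ n), 1:] dvd R"
    by (simp only: poly_eq_0_iff_dvd)
  then show ?case
    unfolding q_shifted_power_Suc R by (rule mult_dvd_mono[OF dvd_refl])
qed

section \<open>The factorization and the degree of the radical\<close>

text \<open>A zero \<open>z \<noteq> 0\<close> lies behind some start of a run, and the run that begins there is finite and not
  empty, so splitting it off lowers the degree.\<close>

lemma q_factorization_exists:
  assumes "P \<noteq> 0"
  shows "\<exists>xs. q_factorization q P xs"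
  using assms
proof (induction "degree P" arbitrary: P rule: less_induct)
  case less
  have split: "P1 \<noteq> 0 \<and> degree P1 < degree P"
    if "P = q_shifted_power q w n * P1" and "n > 0" for w n P1
    using that less.prems
    by (auto simp: degree_mult_eq q_shifted_power_nonzero degree_q_shifted_power)
  consider "poly P 0 = 0" | z where "z \<noteq> 0" "poly P z = 0" | "degree P = 0"
    using fundamental_theorem_of_algebra[of P] constant_degree[of P] by metis
  then show ?case
  proof cases
    case 1
    let ?n = "order 0 P"
    obtain P1 where P1: "P = q_shifted_power q 0 ?n * P1"
      using order_1[of 0 P] by (auto simp: q_shifted_power_origin elim: dvdE)
    have "?n > 0"
      using 1 less.prems by (simp add: order_gt_0_iff)
    then show ?thesis
      using split[OF P1] less.hyps q_factorization.origin[OF 1 refl P1] by blast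
  next
    case 2
    then obtain w where w: "w \<noteq> 0" "poly P w = 0" "poly P (w / q) \<noteq> 0"
      using chain_start_exists less.prems by blast
    define n where "n = (LEAST n. poly P (q ^ n * w) \<noteq> 0)"
    have n: "poly P (q ^ n * w) \<noteq> 0"
      unfolding n_def using orbit_leaves_zeros(1)[OF less.prems w(1)] by (rule LeastI_ex)
    have run: "poly P (q ^ k * w) = 0" if "k < n" for k
      using that not_less_Least unfolding n_def by blast
    obtain P1 where P1: "P = q_shifted_power q w n * P1"
      using q_shifted_power_dvd[OF w(1) run] by (auto elim: dvdE)
    have "n > 0"
      using n w(2) by (cases n) auto
    then obtain xs where xs: "q_factorization q P1 xs"
      using split[OF P1] less.hyps by blast
    have "has_q_weight q (poly P) w (enat n)"
      using has_q_weight_iff_run_length[OF w(1)] n run by blast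
    moreover have "poly P1 (q ^ n * w) \<noteq> 0"
      using n by (subst (asm) P1) simp
    moreover have "poly P (inverse q * w) \<noteq> 0"
      using w(3) by (simp add: field_simps)
    ultimately show ?thesis
      using q_factorization.step[OF w(2) _ _ P1 _ xs] by blast
  next
    case 3
    then obtain A where "P = [:A:]"
      by (rule degree_eq_zeroE)
    then show ?thesis
      using q_factorization.const[of A q] less.prems by auto
  qed
qed

lemma q_factorization_nonzero: "q_factorization q P xs \<Longrightarrow> P \<noteq> 0"
proof (induction rule: q_factorization.induct)
  case (origin P n P1 xs)
  then show ?case
    by (metis mult_eq_0_iff q_shifted_power_nonzero)
next
  case (step P w n P1 xs)
  then show ?case
    by (metis mult_eq_0_iff q_shifted_power_nonzero)
qed simp

text \<open>The right-hand side depends only on \<open>P\<close>, so the factorization is unique up to order.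
  Splitting off the run \<open>w, q * w, \<dots>, q\<^bsup>n-1\<^esup> * w\<close> changes the jump of the multiplicity only
  at its two ends. At \<open>w\<close> it drops by one, and this is not lost in truncation because
  \<open>w / q\<close> is not a zero. At \<open>q\<^sup>n * w\<close> it would grow by one, but the truncated value is
  \<open>0\<close> before and after because \<open>q\<^sup>n * w\<close> is not a zero.\<close>

lemma count_q_factorization:
  assumes "q_factorization q P xs"
  shows "count (mset (map fst xs)) z = chain_starts q P z"
  using assms
proof (induction rule: q_factorization.induct)
  case (const A)
  then show ?case
    by (simp add: chain_starts_def order_0I)
next
  case (origin P n P1 xs)
  have nz: "P \<noteq> 0" "P1 \<noteq> 0"
    using q_factorization_nonzero[OF origin.hyps(4)] origin.hyps(3)
    by (auto simp: q_shifted_power_nonzero)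
  have ord: "order w P = order w ([:0, 1:] ^ n) + order w P1" for w
    using origin.hyps(3) nz by (simp add: order_mult q_shifted_power_origin)
  have "order 0 P1 = 0"
    using ord[of 0] order_power_n_n[of "0::complex" n] origin.hyps(2) by simp
  then have "poly P1 0 \<noteq> 0"
    using nz by (simp add: order_eq_0_iff)
  moreover have "order w P = order w P1" if "w \<noteq> 0" for w
    using ord[of w] that by (simp add: order_0I)
  ultimately show ?case
    using origin.IH origin.hyps(1) q_nonzero by (auto simp: chain_starts_def)
next
  case (step P w n P1 xs)
  have w: "w \<noteq> 0"
    using step.hyps(1,2) by auto
  have nz: "P \<noteq> 0" "P1 \<noteq> 0"
    using q_factorization_nonzero[OF step.hyps(6)] step.hyps(4)
    by (auto simp: q_shifted_power_nonzero)
  \<comment> \<open>the multiplicity function of the factor that is split off\<close>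
  define run :: "complex \<Rightarrow> nat" where "run x = of_bool (\<exists>k<n. x = w * q ^ k)" for x
  have ord: "order x P = run x + order x P1" for x
    using step.hyps(4) nz by (simp add: order_mult order_q_shifted_power w run_def)
  have n: "n > 0"
    using step.hyps(1,3) by (cases n) (auto simp: has_q_weight_iff_run_length w)
  show ?case
  proof (cases "z = 0")
    case True
    have "order 0 P = order 0 P1"
      using ord[of 0] w q_nonzero by (auto simp: run_def)
    then have "poly P 0 = 0 \<longleftrightarrow> poly P1 0 = 0"
      using nz by (metis order_eq_0_iff)
    then show ?thesis
      using step.IH True w by (simp add: chain_starts_def)
  next
    case False
    have ends: "run w = 1" "run (w / q) = 0" "run (w * q ^ n) = 0" "run (w * q ^ n / q) = 1"
    proof -
      show "run w = 1" using n by (auto simp: run_def intro!: exI[of _ 0])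
      have "order (w / q) P = 0"
        using step.hyps(2) by (intro order_0I) (simp add: field_simps)
      then show "run (w / q) = 0" using ord[of "w / q"] by simp
      show "run (w * q ^ n) = 0" using w by (auto simp: run_def q_power_inj)
      show "run (w * q ^ n / q) = 1" using n q_nonzero
        by (cases n) (auto simp: run_def)
    qed
    have start: "order (w / q) P1 = 0"
      using step.hyps(2) ord[of "w / q"] order_0I[of P "w / q"] by (simp add: field_simps)
    have stop: "order (w * q ^ n) P1 = 0"
      using step.hyps(5) by (intro order_0I) (simp add: mult.commute)
    consider "z = w" | "z = w * q ^ n" | "z \<noteq> w" "z \<noteq> w * q ^ n" by blast
    then have "chain_starts q P z = of_bool (z = w) + chain_starts q P1 z"
    proof cases
      case 1
      then show ?thesis
        using ends start w by (simp add: chain_starts_def ord)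
    next
      case 2
      then have "z \<noteq> w"
        using ends by auto
      moreover have "run z = 0" and "order z P1 = 0"
        using 2 ends stop by simp_all
      ultimately show ?thesis
        using False by (simp add: chain_starts_def ord)
    next
      case 3
      \<comment> \<open>away from its two ends, the run contains both or neither of \<open>z\<close> and \<open>z / q\<close>\<close>
      have "(\<exists>k<n. z = w * q ^ k) \<longleftrightarrow> (\<exists>k<n. z = w * q ^ Suc k)"
      proof
        assume "\<exists>k<n. z = w * q ^ k"
        then obtain k where "k < n" "z = w * q ^ k" by blast
        then show "\<exists>k<n. z = w * q ^ Suc k"
          using 3 by (cases k) (auto intro!: exI[of _ "k - 1"])
      next
        assume "\<exists>k<n. z = w * q ^ Suc k"
        then obtain k where k: "k < n" "z = w * q ^ Suc k" by blast
        then have "Suc k \<noteq> n" using 3 by auto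
        then show "\<exists>k<n. z = w * q ^ k"
          using k by (intro exI[of _ "Suc k"]) auto
      qed
      then have "run z = run (z / q)"
        using q_nonzero by (simp add: run_def field_simps)
      then show ?thesis
        using 3 False by (simp add: chain_starts_def ord)
    qed
    then show ?thesis
      using step.IH by simp
  qed
qed

lemma degree_q_radical:
  assumes "q_factorization q P xs"
  shows "degree (q_radical q P) = length xs"
proof -
  define rad where "rad ys = (\<Prod>(z, n)\<leftarrow>ys. [:- z, 1:] :: complex poly)" for ys :: "(complex \<times> nat) list"
  have rad: "rad ys = (\<Prod>z\<in>#mset (map fst ys). [:- z, 1:])" for ys
    unfolding rad_def by (induction ys) auto
  have "rad ys = rad xs" if "q_factorization q P ys" for ys
  proof -
    have "mset (map fst ys) = mset (map fst xs)"
      using count_q_factorization[OF that] count_q_factorization[OF assms]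
      by (intro multiset_eqI) metis
    then show ?thesis by (simp only: rad)
  qed
  then have "q_radical q P = rad xs"
    unfolding q_radical_def rad_def using assms by (intro the_equality) blast+
  moreover have "degree (rad xs) = length xs"
  proof -
    have "rad ys \<noteq> 0 \<and> degree (rad ys) = length ys" for ys
      unfolding rad_def
      by (induction ys) (auto simp: degree_mult_eq simp del: mult_pCons_left)
    then show ?thesis by blast
  qed
  ultimately show ?thesis by simp
qed

section \<open>Vanishing of the Casoratian\<close>

text \<open>Comparing leading coefficients in \<open>f(z) * h(q * z) = f(q * z) * h(z)\<close> yields
  \<open>q ^ degree h = q ^ degree f\<close>, so every nonzero \<open>h\<close> that solves this linear equation has the
  degree of \<open>f\<close>. The combination of \<open>f\<close> and \<open>g\<close> in which the leading terms
  cancel is a solution of smaller degree, hence zero.\<close>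

lemma casoratian_eq_0_imp_smult:
  assumes "casoratian q f g = 0" and "f \<noteq> 0" and "g \<noteq> 0"
  obtains k where "g = smult k f"
proof -
  have lead: "lead_coeff (pcompose h [:0, q:]) = lead_coeff h * q ^ degree h"
    for h :: "complex poly"
    using q_nonzero by (subst lead_coeff_comp) auto
  have deg_eq: "degree h = degree f" if "casoratian q f h = 0" "h \<noteq> 0" for h
  proof -
    have "f * pcompose h [:0, q:] = pcompose f [:0, q:] * h"
      using that(1) by (simp add: casoratian_def)
    then have "lead_coeff f * (lead_coeff h * q ^ degree h) =
        lead_coeff f * q ^ degree f * lead_coeff h"
      by (metis lead lead_coeff_mult)
    then show ?thesis
      using assms(2) that(2) by (simp add: q_power_inj)
  qed
  define k where "k = lead_coeff g / lead_coeff f"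
  define h where "h = g - smult k f"
  have "casoratian q f h = casoratian q f g"
    by (simp add: casoratian_def h_def pcompose_diff pcompose_smult algebra_simps)
  moreover have "degree h < degree f" if "h \<noteq> 0"
  proof -
    have same: "degree g = degree f"
      using deg_eq assms by blast
    have "degree h \<le> degree f"
      unfolding h_def using same by (intro degree_diff_le) auto
    moreover have "coeff h (degree f) = 0"
      using assms(2) same by (simp add: h_def k_def)
    ultimately show ?thesis
      using that by (metis leading_coeff_0_iff le_neq_implies_less)
  qed
  ultimately have "h = 0"
    using deg_eq[of h] assms(1) by force
  then show thesis
    using that[of k] by (simp add: h_def)
qed

section \<open>Comparing the radical with the Casoratian\<close>

text \<open>Summation over all points of a pointwise bound for multiplicities, phrased with multisets so
  that no range of summation has to be chosen. The shift by \<open>q\<close> permutes the points, so the orders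
  of \<open>D\<close> at the points \<open>z / q\<close> add up to its degree. The multiset \<open>M\<close> records a surplus.\<close>

lemma degree_le_radical_from_orders:
  assumes "P \<noteq> 0" and "D \<noteq> 0"
    and "\<And>z. order z P + count M z \<le> chain_starts q P z + order (z / q) D"
  shows "degree P + size M \<le> degree (q_radical q P) + degree D"
proof -
  obtain xs where xs: "q_factorization q P xs"
    using q_factorization_exists assms(1) by blast
  have "count (image_mset ((*) q) N) z = count N (z / q)" for N z
    using q_nonzero by (induction N) (auto simp: field_simps)
  then have shifted: "count (image_mset ((*) q) (proots D)) z = order (z / q) D" for z
    using assms(2) by simp
  have "proots P + M \<subseteq># mset (map fst xs) + image_mset ((*) q) (proots D)"
    unfolding subseteq_mset_def count_union count_q_factorization[OF xs] shifted
    using assms(1,3) by simp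
  then have "size (proots P + M) \<le> size (mset (map fst xs) + image_mset ((*) q) (proots D))"
    by (rule size_mset_mono)
  then show ?thesis
    by (simp add: size_proots_complex degree_q_radical[OF xs])
qed

text \<open>Pointwise, \<open>m z \<le> (m z - m (z / q)) + min (m z) (m (z / q))\<close> for \<open>z \<noteq> 0\<close>, and the order of \<open>D\<close> at
  \<open>z / q\<close> covers the minimum. At the origin the surplus is one: if \<open>P\<close> vanishes there, the radical
  contributes \<open>1\<close> and \<open>D\<close> vanishes to order at least \<open>m 0\<close>; otherwise \<open>D 0 = 0\<close> suffices.\<close>

lemma degree_prod_less_radical_plus:
  assumes "q_disjoint q f g" and "q_disjoint q f h" and "q_disjoint q g h"
    and nz: "f * g * h \<noteq> 0" and D: "D \<noteq> 0" "poly D 0 = 0"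
    and overlap: "\<And>r w n. r \<in> {f, g, h} \<Longrightarrow> [:- w, 1:] ^ n dvd r \<Longrightarrow>
      [:- (q * w), 1:] ^ n dvd r \<Longrightarrow> [:- w, 1:] ^ n dvd D"
  shows "degree (f * g * h) + 1 \<le> degree (q_radical q (f * g * h)) + degree D"
proof -
  define P where "P = f * g * h"
  have "order z P + count {#0#} z \<le> chain_starts q P z + order (z / q) D" for z
  proof (cases "poly P z = 0 \<and> poly P (z / q) = 0")
    case True
    define w where "w = z / q"
    have z: "z = q * w"
      using q_nonzero by (simp add: w_def)
    have "poly (f * g * h) w = 0" and "poly (f * g * h) (q * w) = 0"
      using True unfolding w_def[symmetric] z[symmetric] P_def by blast+
    then obtain r s where r: "r \<in> {f, g, h}" "P = r * s"
      and s: "poly s w \<noteq> 0" "poly s (q * w) \<noteq> 0"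
      unfolding P_def by (rule consecutive_zeros_in_one_factor[OF assms(1-3)])
    have "r * s \<noteq> 0"
      using nz unfolding P_def[symmetric] r(2) .
    then have "order x P = order x r + order x s" for x
      unfolding r(2) by (rule order_mult)
    then have ord: "order w P = order w r" "order z P = order z r"
      using s by (simp_all add: z order_0I)
    define n where "n = min (order w r) (order z r)"
    have "[:- w, 1:] ^ n dvd r" "[:- (q * w), 1:] ^ n dvd r"
      unfolding n_def z by (simp_all add: order_divides)
    then have "n \<le> order w D"
      using overlap[OF r(1)] D(1) by (metis order_divides)
    then show ?thesis
      using True ord by (auto simp: chain_starts_def n_def w_def)
  next
    case False
    then consider "z = 0" "poly P 0 \<noteq> 0" | "z \<noteq> 0" "order z P = 0" | "z \<noteq> 0" "order (z / q) P = 0"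
      using order_0I[of P z] order_0I[of P "z / q"] by (cases "z = 0") auto
    then show ?thesis
    proof cases
      case 1
      moreover have "order 0 D > 0"
        using D by (simp add: order_gt_0_iff)
      ultimately show ?thesis
        by (simp add: order_0I)
    qed (simp_all add: chain_starts_def)
  qed
  then show ?thesis
    using degree_le_radical_from_orders[of P D "{#0#}"] nz D(1) by (simp add: P_def)
qed

text \<open>Every run has length one in this case, so a zero of multiplicity \<open>m\<close> is the start of \<open>m\<close> runs.
  The origin cannot be a zero because it follows itself.\<close>

lemma degree_le_radical_if_no_consecutive_zeros:
  assumes "P \<noteq> 0" and "\<And>z. poly P z = 0 \<Longrightarrow> poly P (q * z) \<noteq> 0"
  shows "degree P \<le> degree (q_radical q P)"
proof -
  have "order z P \<le> chain_starts q P z" for z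
  proof (cases "poly P z = 0")
    case True
    then have "z \<noteq> 0"
      using assms(2)[of 0] by auto
    moreover have "poly P (z / q) \<noteq> 0"
      using assms(2)[of "z / q"] True q_nonzero by auto
    ultimately show ?thesis
      by (simp add: chain_starts_def order_0I)
  qed (simp add: order_0I)
  then show ?thesis
    using degree_le_radical_from_orders[of P 1 "{#}"] assms(1) by simp
qed

section \<open>Mason's theorem for q-differences\<close>

lemma q_mason:
  assumes disj: "q_disjoint q a b" "q_disjoint q a c" "q_disjoint q b c"
    and sum: "a + b = c" and nz: "a \<noteq> 0" "b \<noteq> 0" "c \<noteq> 0"
    and nonconst: "\<not> (degree a = 0 \<and> degree b = 0 \<and> degree c = 0)"
  shows "Max {degree a, degree b, degree c} < degree (q_radical q (a * b * c))"
proof (cases "casoratian q a b = 0")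
  case False
  define D where "D = casoratian q a b"
  have D: "D = casoratian q a c" "D = casoratian q c b" "D = - casoratian q b a"
    unfolding D_def sum[symmetric]
    by (simp_all add: casoratian_add_left casoratian_add_right casoratian_commute[of q a b])
  have overlap: "[:- w, 1:] ^ n dvd D"
    if r: "r \<in> {a, b, c}" "[:- w, 1:] ^ n dvd r" "[:- (q * w), 1:] ^ n dvd r" for r w n
  proof -
    have dvd: "[:- w, 1:] ^ n dvd casoratian q r g" for g
      by (rule linear_power_dvd_casoratian[OF q_nonzero r(2,3)])
    consider "r = a" | "r = b" | "r = c"
      using r(1) by blast
    then show ?thesis
    proof cases
      case 1
      then show ?thesis using dvd[of b] by (simp add: D_def)
    next
      case 2
      then show ?thesis using dvd[of a] by (simp only: D(3) dvd_minus_iff)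
    next
      case 3
      then show ?thesis using dvd[of b] by (simp only: D(2))
    qed
  qed
  have "degree (a * b * c) + 1 \<le> degree (q_radical q (a * b * c)) + degree D"
  proof (rule degree_prod_less_radical_plus[OF disj _ _ _ overlap])
    show "a * b * c \<noteq> 0" using nz by simp
    show "D \<noteq> 0" using False by (simp add: D_def)
    show "poly D 0 = 0" by (simp add: D_def poly_casoratian_0)
  qed
  moreover have "degree (a * b * c) = degree a + degree b + degree c"
    using nz by (simp add: degree_mult_eq)
  moreover have "degree D \<le> degree a + degree b"
    unfolding D_def by (rule degree_casoratian_le)
  moreover have "degree D \<le> degree a + degree c"
    unfolding D(1) by (rule degree_casoratian_le)
  moreover have "degree D \<le> degree c + degree b"
    unfolding D(2) by (rule degree_casoratian_le)
  ultimately show ?thesis by simp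
next
  case True
  obtain k where b: "b = smult k a"
    using casoratian_eq_0_imp_smult[OF True nz(1,2)] .
  have c: "c = smult (1 + k) a"
    using sum unfolding b by (simp add: smult_add_left)
  have k: "k \<noteq> 0" "1 + k \<noteq> 0"
    using nz unfolding b c by auto
  have deg: "degree b = degree a" "degree c = degree a"
    unfolding b c using k by simp_all
  have "degree (a * b * c) \<le> degree (q_radical q (a * b * c))"
  proof (rule degree_le_radical_if_no_consecutive_zeros)
    show "a * b * c \<noteq> 0"
      using nz by simp
    show "poly (a * b * c) (q * z) \<noteq> 0" if "poly (a * b * c) z = 0" for z
      using that disj(1) k unfolding b c by (auto simp: q_disjoint_def)
  qed
  then show ?thesis
    using nonconst deg nz by (simp add: degree_mult_eq)
qed

end

theorem theorem3p2:
  fixes q :: complex and a b c :: "complex poly"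
  assumes "q \<noteq> 0" and "norm q \<noteq> 1"
    and "relatively_q_prime q [poly a, poly b, poly c]"
    and "a + b = c"
    and "\<not> (degree a = 0 \<and> degree b = 0 \<and> degree c = 0)"
  shows "int (Max {degree a, degree b, degree c}) \<le> int (degree (q_radical q (a * b * c))) - 1"
proof -
  note disjoint = q_disjoint_if_relatively_q_prime[of q "[a, b, c]"]
  have ab: "q_disjoint q a b"
    using disjoint[of 0 1] assms(3) by simp
  have ac: "q_disjoint q a c"
    using disjoint[of 0 2] assms(3) by simp
  have bc: "q_disjoint q b c"
    using disjoint[of 1 2] assms(3) by simp
  \<comment> \<open>if one of the three vanished identically, the other two would be constant, hence all three\<close>
  have const: "degree f = 0" if "q_disjoint q 0 f \<or> q_disjoint q f 0" for f
    using that q_disjoint_0_imp_constant by (auto simp: q_disjoint_commute)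
  have "a \<noteq> 0" "b \<noteq> 0" "c \<noteq> 0"
    using const ab ac bc assms(5) by fastforce+
  then have "Max {degree a, degree b, degree c} < degree (q_radical q (a * b * c))"
    using q_mason[OF assms(1,2) ab ac bc assms(4)] assms(5) by blast
  then show ?thesis by linarith
qed

end
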